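(* Let $\Omega\subseteq\mathbb{C}$ be a domain, $n\in\mathbb{N}$, and let $\mathcal{L}=\{\mathcal{L}(\lambda):\lambda\in\Omega\}$ be a family of $n\times n$ operator matrices in $\mathcal{H}=\mathcal{H}_1\oplus\cdots\oplus\mathcal{H}_n$. The pseudo block numerical range $W^n_\Psi(\mathcal{L})$ satisfies $$W^n(\mathcal{L})\subseteq W^n_{\Psi,1}(\mathcal{L})\subseteq W^n_{\Psi,0}(\mathcal{L})\subseteq W^n_{\Psi,2}(\mathcal{L})\subseteq W^n_\Psi(\mathcal{L}).$$
   Context: $\mathcal{H}_1,\dots,\mathcal{H}_n$ are complex Hilbert spaces. The family consists of densely defined operators $\mathcal{L}(\lambda)=(L_{ij}(\lambda))_{i,j=1}^n$ in $\mathcal{H}$, where each $L_{ij}(\lambda)$ is a densely defined closable linear operator from $\mathcal{H}_j$ to $\mathcal{H}_i$, with $\operatorname{dom}\mathcal{L}(\lambda)=\mathcal{D}_1(\lambda)\oplus\cdots\oplus\mathcal{D}_n(\lambda)$, $\mathcal{D}_j(\lambda)=\bigcap_{i=1}^n\operatorname{dom}L_{ij}(\lambda)$. Let $\mathcal{S}^n=\{f=(f_i)_{i=1}^n\in\mathcal{H}:\|f_i\|=1,\ i=1,\dots,n\}$ and, for $f\in\operatorname{dom}\mathcal{L}(\lambda)\cap\mathcal{S}^n$, $\mathcal{L}(\lambda)_f=\big((L_{ij}(\lambda)f_j,f_i)\big)_{i,j=1}^n\in\mathbb{C}^{n\times n}$. Block numerical range of the family: $W^n(\mathcal{L})=\{\lambda\in\Omega:\exists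 f\in\operatorname{dom}\mathcal{L}(\lambda)\cap\mathcal{S}^n,\ 0\in\sigma(\mathcal{L}(\lambda)_f)\}$. Block numerical range of a single densely defined operator matrix $\mathcal{A}=(A_{ij})_{i,j=1}^n$ in $\mathcal{H}$, where each $A_{ij}$ is a densely defined closable linear operator from $\mathcal{H}_j$ to $\mathcal{H}_i$ and $\operatorname{dom}\mathcal{A}=\bigoplus_{j=1}^n\bigcap_{i=1}^n\operatorname{dom}A_{ij}$: $W^n(\mathcal{A})=\bigcup_{f\in\operatorname{dom}\mathcal{A}\cap\mathcal{S}^n}\sigma(\mathcal{A}_f)$ with $\mathcal{A}_f=\big((A_{ij}f_j,f_i)\big)_{i,j=1}^n\in\mathbb{C}^{n\times n}$. Pseudo block numerical range: $W^n_\Psi(\mathcal{L})=\bigcap_{\varepsilon>0}W^n_\varepsilon(\mathcal{L})$ with $W^n_\varepsilon(\mathcal{L})=\bigcup_{\mathcal{B}\in L(\mathcal{H}),\|\mathcal{B}\|<\varepsilon}W^n(\mathcal{L}+\mathcal{B})$. Further, $W^n_{\Psi,0}(\mathcal{L})=\{\lambda\in\Omega:0\in\overline{W^n(\mathcal{L}(\lambda))}\}$ and $W^n_{\Psi,i}(\mathcal{L})=\bigcap_{\varepsilon>0}W^n_{\varepsilon,i}(\mathcal{L})$, $i=1,2$, with $W^n_{\varepsilon,1}(\mathcal{L})=\{\lambda\in\Omega:\exists f\in\operatorname{dom}\mathcal{L}(\lambda)\cap\mathcal{S}^n,\ |\det(\mathcal{L}(\lambda)_f)|<\varepsilon\}$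 and $W^n_{\varepsilon,2}(\mathcal{L})=\bigcup_{B_i\in L(\mathcal{H}_i),\|B_i\|<\varepsilon}W^n(\mathcal{L}+\operatorname{diag}(B_1,\dots,B_n))$. *)

theory Defs
  imports "HOL-Analysis.Analysis"
begin

text \<open>
  Complex Hilbert spaces as a type class over \<^class>\<open>banach\<close>. The inner product is linear in its
  first argument. Positive definiteness is a consequence of the last axiom and of the norm axioms.
\<close>

class complex_hilbert_space = banach +
  fixes scaleC :: "complex \<Rightarrow> 'a \<Rightarrow> 'a"  (infixr "*\<^sub>C" 75)
    and cinner :: "'a \<Rightarrow> 'a \<Rightarrow> complex"
  assumes scaleR_scaleC: "r *\<^sub>R x = complex_of_real r *\<^sub>C x"
    and scaleC_add_right: "a *\<^sub>C (x + y) = a *\<^sub>C x + a *\<^sub>C y"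
    and scaleC_add_left: "(a + b) *\<^sub>C x = a *\<^sub>C x + b *\<^sub>C x"
    and scaleC_scaleC: "a *\<^sub>C (b *\<^sub>C x) = (a * b) *\<^sub>C x"
    and scaleC_one: "1 *\<^sub>C x = x"
    and cinner_commute: "cinner x y = cnj (cinner y x)"
    and cinner_add_left: "cinner (x + y) z = cinner x z + cinner y z"
    and cinner_scaleC_left: "cinner (a *\<^sub>C x) y = a * cinner x y"
    and norm_eq_sqrt_cinner: "norm x = sqrt (Re (cinner x x))"

global_interpretation complex_vector: vector_space "scaleC :: complex \<Rightarrow> 'a \<Rightarrow> 'a::complex_hilbert_space"
  by unfold_locales
    (simp_all add: scaleC_add_right scaleC_add_left scaleC_scaleC scaleC_one)

instantiation complex :: complex_hilbert_space
begin

definition scaleC_complex :: "complex \<Rightarrow> complex \<Rightarrow> complex"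
  where "scaleC_complex a x = a * x"

definition cinner_complex :: "complex \<Rightarrow> complex \<Rightarrow> complex"
  where "cinner_complex x y = x * cnj y"

instance
  by standard
    (simp_all add: scaleC_complex_def cinner_complex_def algebra_simps scaleR_conv_of_real
      cmod_def power2_eq_square)

end

text \<open>The Hilbert space direct sum of finitely many copies of \<open>'a\<close>.\<close>

instantiation vec :: (complex_hilbert_space, finite) complex_hilbert_space
begin

definition scaleC_vec :: "complex \<Rightarrow> 'a ^ 'b \<Rightarrow> 'a ^ 'b"
  where "scaleC_vec a f = (\<chi> i. a *\<^sub>C (f $ i))"

definition cinner_vec :: "'a ^ 'b \<Rightarrow> 'a ^ 'b \<Rightarrow> complex"
  where "cinner_vec f g = (\<Sum>i\<in>UNIV. cinner (f $ i) (g $ i))"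

instance
proof
  fix f g h :: "'a ^ 'b" and a b :: complex and r :: real
  show "r *\<^sub>R f = complex_of_real r *\<^sub>C f"
    by (simp add: scaleC_vec_def vec_eq_iff scaleR_scaleC)
  show "a *\<^sub>C (f + g) = a *\<^sub>C f + a *\<^sub>C g" "(a + b) *\<^sub>C f = a *\<^sub>C f + b *\<^sub>C f"
    "a *\<^sub>C b *\<^sub>C f = (a * b) *\<^sub>C f" "1 *\<^sub>C f = f"
    by (simp_all add: scaleC_vec_def vec_eq_iff scaleC_add_right scaleC_add_left)
  show "cinner f g = cnj (cinner g f)"
    unfolding cinner_vec_def cnj_sum by (rule sum.cong[OF refl]) (rule cinner_commute)
  show "cinner (f + g) h = cinner f h + cinner g h"
    by (simp add: cinner_vec_def cinner_add_left sum.distrib)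
  show "cinner (a *\<^sub>C f) g = a * cinner f g"
    by (simp add: cinner_vec_def scaleC_vec_def cinner_scaleC_left sum_distrib_left)
  have "(norm x)\<^sup>2 = Re (cinner x x)" for x :: 'a
  proof -
    have "0 \<le> sqrt (Re (cinner x x))"
      unfolding norm_eq_sqrt_cinner[symmetric] by simp
    then show ?thesis
      by (simp add: norm_eq_sqrt_cinner)
  qed
  then show "norm f = sqrt (Re (cinner f f))"
    by (simp add: norm_vec_def L2_set_def cinner_vec_def)
qed

end


text \<open>
  A Hilbert space is given as a closed subspace of a type of class
  \<^class>\<open>complex_hilbert_space\<close>, with the induced structure. This lets finitely many different
  spaces share one type: arbitrary Hilbert spaces \<open>H\<^sub>1, \<dots>, H\<^sub>n\<close> are closed subspaces of, say, their own
  direct sum. No relation between the subspaces is assumed.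
\<close>

definition hilbert_subspace :: "'a::complex_hilbert_space set \<Rightarrow> bool"
  where "hilbert_subspace V \<longleftrightarrow> complex_vector.subspace V \<and> closed V"

text \<open>
  The external direct sum \<open>H\<^sub>1 \<oplus> \<dots> \<oplus> H\<^sub>n\<close>, where \<open>n\<close> is the cardinality of the index type \<open>'n\<close>.
\<close>

definition direct_sum :: "('n::finite \<Rightarrow> 'a::complex_hilbert_space set) \<Rightarrow> ('a ^ 'n) set"
  where "direct_sum H = {f. \<forall>i. f $ i \<in> H i}"

definition linear_on ::
  "'a::complex_hilbert_space set \<Rightarrow> ('a \<Rightarrow> 'b::complex_hilbert_space) \<Rightarrow> bool"
  where "linear_on V T \<longleftrightarrow>
    (\<forall>x\<in>V. \<forall>y\<in>V. T (x + y) = T x + T y) \<and> (\<forall>c. \<forall>x\<in>V. T (c *\<^sub>C x) = c *\<^sub>C T x)"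

text \<open>The algebra \<open>L(V)\<close>; the values of \<open>T\<close> outside \<open>V\<close> are irrelevant.\<close>

definition bounded_ops :: "'a::complex_hilbert_space set \<Rightarrow> ('a \<Rightarrow> 'a) set"
  where "bounded_ops V =
    {T. T \<in> V \<rightarrow> V \<and> linear_on V T \<and> (\<exists>K. \<forall>x\<in>V. norm (T x) \<le> K * norm x)}"

text \<open>The operator norm, in the form of \<^const>\<open>onorm\<close>; the point \<open>x = 0\<close> contributes \<open>0 / 0 = 0\<close>.\<close>

definition onorm_on :: "'a::complex_hilbert_space set \<Rightarrow> ('a \<Rightarrow> 'a) \<Rightarrow> real"
  where "onorm_on V T = (SUP x\<in>V. norm (T x) / norm x)"


text \<open>Unbounded operators; the values of \<open>op_app\<close> outside \<open>op_dom\<close> are irrelevant.\<close>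

record 'a operator =
  op_dom :: "'a set"
  op_app :: "'a \<Rightarrow> 'a"

definition linear_operator ::
  "'a::complex_hilbert_space set \<Rightarrow> 'a set \<Rightarrow> 'a operator \<Rightarrow> bool"
  where "linear_operator V W T \<longleftrightarrow>
    complex_vector.subspace (op_dom T) \<and> op_dom T \<subseteq> V \<and>
    op_app T \<in> op_dom T \<rightarrow> W \<and> linear_on (op_dom T) (op_app T)"

definition densely_defined :: "'a::complex_hilbert_space set \<Rightarrow> 'a operator \<Rightarrow> bool"
  where "densely_defined V T \<longleftrightarrow> V \<subseteq> closure (op_dom T)"

text \<open>The closure of the graph is again the graph of a function.\<close>

definition closable :: "'a::complex_hilbert_space operator \<Rightarrow> bool"
  where "closable T \<longleftrightarrow> single_valued (closure ((\<lambda>x. (x, op_app T x)) ` op_dom T))"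


text \<open>The entry \<open>A i j\<close> is an operator from \<open>H j\<close> to \<open>H i\<close>.\<close>

type_synonym ('a, 'n) operator_matrix = "'n \<Rightarrow> 'n \<Rightarrow> 'a operator"

definition matrix_dom :: "('a::complex_hilbert_space, 'n::finite) operator_matrix \<Rightarrow> ('a ^ 'n) set"
  where "matrix_dom A = {f. \<forall>j. f $ j \<in> (\<Inter>i. op_dom (A i j))}"

definition is_operator_matrix ::
  "('n::finite \<Rightarrow> 'a::complex_hilbert_space set) \<Rightarrow> ('a, 'n) operator_matrix \<Rightarrow> bool"
  where "is_operator_matrix H A \<longleftrightarrow>
    (\<forall>i j. linear_operator (H j) (H i) (A i j) \<and> densely_defined (H j) (A i j) \<and>
      closable (A i j)) \<and>
    direct_sum H \<subseteq> closure (matrix_dom A)"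

text \<open>
  The sum of an operator matrix and an everywhere defined operator \<open>B\<close> on the direct sum. The
  \<open>(i, j)\<close> block of \<open>B\<close> maps \<open>x \<in> H j\<close> to the \<open>i\<close>-th component of \<open>B (0, \<dots>, x, \<dots>, 0)\<close>.
\<close>

definition perturb ::
  "('a::complex_hilbert_space, 'n::finite) operator_matrix \<Rightarrow> ('a ^ 'n \<Rightarrow> 'a ^ 'n) \<Rightarrow>
    ('a, 'n) operator_matrix"
  where "perturb A B = (\<lambda>i j.
    \<lparr>op_dom = op_dom (A i j), op_app = (\<lambda>x. op_app (A i j) x + B (axis j x) $ i)\<rparr>)"

definition diag_op ::
  "('n::finite \<Rightarrow> 'a \<Rightarrow> 'a::complex_hilbert_space) \<Rightarrow> 'a ^ 'n \<Rightarrow> 'a ^ 'n"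
  where "diag_op B f = (\<chi> i. B i (f $ i))"


definition unit_product :: "('n::finite \<Rightarrow> 'a::complex_hilbert_space set) \<Rightarrow> ('a ^ 'n) set"
  where "unit_product H = {f \<in> direct_sum H. \<forall>i. norm (f $ i) = 1}"

definition compression ::
  "('a::complex_hilbert_space, 'n::finite) operator_matrix \<Rightarrow> 'a ^ 'n \<Rightarrow> complex ^ 'n ^ 'n"
  where "compression A f = (\<chi> i j. cinner (op_app (A i j) (f $ j)) (f $ i))"

definition matrix_spectrum :: "complex ^ 'n ^ 'n \<Rightarrow> complex set"
  where "matrix_spectrum M = {\<mu>. \<not> invertible (M - mat \<mu>)}"

definition bnr ::
  "('n::finite \<Rightarrow> 'a::complex_hilbert_space set) \<Rightarrow> ('a, 'n) operator_matrix \<Rightarrow> complex set"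
  where "bnr H A = (\<Union>f \<in> matrix_dom A \<inter> unit_product H. matrix_spectrum (compression A f))"

definition bnr_family ::
  "('n::finite \<Rightarrow> 'a::complex_hilbert_space set) \<Rightarrow> complex set \<Rightarrow>
    (complex \<Rightarrow> ('a, 'n) operator_matrix) \<Rightarrow> complex set"
  where "bnr_family H \<Omega> L =
    {z \<in> \<Omega>. \<exists>f \<in> matrix_dom (L z) \<inter> unit_product H. 0 \<in> matrix_spectrum (compression (L z) f)}"

definition bnr_eps ::
  "('n::finite \<Rightarrow> 'a::complex_hilbert_space set) \<Rightarrow> complex set \<Rightarrow>
    (complex \<Rightarrow> ('a, 'n) operator_matrix) \<Rightarrow> real \<Rightarrow> complex set"
  where "bnr_eps H \<Omega> L \<epsilon> =
    (\<Union>B \<in> {B \<in> bounded_ops (direct_sum H). onorm_on (direct_sum H) B < \<epsilon>}.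
      bnr_family H \<Omega> (\<lambda>z. perturb (L z) B))"

definition bnr_eps1 ::
  "('n::finite \<Rightarrow> 'a::complex_hilbert_space set) \<Rightarrow> complex set \<Rightarrow>
    (complex \<Rightarrow> ('a, 'n) operator_matrix) \<Rightarrow> real \<Rightarrow> complex set"
  where "bnr_eps1 H \<Omega> L \<epsilon> =
    {z \<in> \<Omega>. \<exists>f \<in> matrix_dom (L z) \<inter> unit_product H. cmod (det (compression (L z) f)) < \<epsilon>}"

definition bnr_eps2 ::
  "('n::finite \<Rightarrow> 'a::complex_hilbert_space set) \<Rightarrow> complex set \<Rightarrow>
    (complex \<Rightarrow> ('a, 'n) operator_matrix) \<Rightarrow> real \<Rightarrow> complex set"
  where "bnr_eps2 H \<Omega> L \<epsilon> =
    (\<Union>B \<in> {B. \<forall>i. B i \<in> bounded_ops (H i) \<and> onorm_on (H i) (B i) < \<epsilon>}.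
      bnr_family H \<Omega> (\<lambda>z. perturb (L z) (diag_op B)))"

definition pseudo_bnr ::
  "('n::finite \<Rightarrow> 'a::complex_hilbert_space set) \<Rightarrow> complex set \<Rightarrow>
    (complex \<Rightarrow> ('a, 'n) operator_matrix) \<Rightarrow> complex set"
  where "pseudo_bnr H \<Omega> L = (\<Inter>\<epsilon>\<in>{0<..}. bnr_eps H \<Omega> L \<epsilon>)"

definition pseudo_bnr0 ::
  "('n::finite \<Rightarrow> 'a::complex_hilbert_space set) \<Rightarrow> complex set \<Rightarrow>
    (complex \<Rightarrow> ('a, 'n) operator_matrix) \<Rightarrow> complex set"
  where "pseudo_bnr0 H \<Omega> L = {z \<in> \<Omega>. 0 \<in> closure (bnr H (L z))}"

definition pseudo_bnr1 ::
  "('n::finite \<Rightarrow> 'a::complex_hilbert_space set) \<Rightarrow> complex set \<Rightarrow>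
    (complex \<Rightarrow> ('a, 'n) operator_matrix) \<Rightarrow> complex set"
  where "pseudo_bnr1 H \<Omega> L = (\<Inter>\<epsilon>\<in>{0<..}. bnr_eps1 H \<Omega> L \<epsilon>)"

definition pseudo_bnr2 ::
  "('n::finite \<Rightarrow> 'a::complex_hilbert_space set) \<Rightarrow> complex set \<Rightarrow>
    (complex \<Rightarrow> ('a, 'n) operator_matrix) \<Rightarrow> complex set"
  where "pseudo_bnr2 H \<Omega> L = (\<Inter>\<epsilon>\<in>{0<..}. bnr_eps2 H \<Omega> L \<epsilon>)"

end

theory Submission
  imports Defs "HOL-Computational_Algebra.Fundamental_Theorem_Algebra"
begin

text \<open>
  The determinant of a compression is the product of its eigenvalues, so a determinant below
  \<open>\<epsilon>\<^sup>n\<close> forces an eigenvalue below \<open>\<epsilon>\<close> in modulus. An eigenvalue \<open>\<mu>\<close> of the compression at a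
  point \<open>f\<close> with unit components is moved to \<open>0\<close> by the diagonal perturbation \<open>-\<mu>\<close>, because
  \<open>(f\<^sub>i, f\<^sub>i) = 1\<close>. Finally a diagonal operator has the largest norm of its finitely many entries.
\<close>

section \<open>Determinants of matrices of polynomials of degree at most one\<close>

text \<open>The number of factors stands in for the degree, so constant factors are harmless: with
  one present, both sides of the coefficient identity are \<open>0\<close>. The two claims are
  proved together because the coefficient step uses the degree bound for the smaller
  product.\<close>

lemma coeff_prod_degree_le_1:
  fixes p :: "'i \<Rightarrow> 'b::comm_ring_1 poly"
  assumes "finite S" and "\<And>i. i \<in> S \<Longrightarrow> degree (p i) \<le> 1"
  shows "degree (\<Prod>i\<in>S. p i) \<le> card S \<and>
    coeff (\<Prod>i\<in>S. p i) (card S) = (\<Prod>i\<in>S. coeff (p i) 1)"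
  using assms
proof (induction S rule: finite_induct)
  case (insert i S)
  let ?q = "\<Prod>i\<in>S. p i"
  have q: "degree ?q \<le> card S" "coeff ?q (card S) = (\<Prod>i\<in>S. coeff (p i) 1)"
    and p: "degree (p i) \<le> 1"
    using insert by auto
  have "degree (p i * ?q) \<le> 1 + card S"
    using degree_mult_le[of "p i" ?q] p q(1) by linarith
  moreover have "coeff (p i * ?q) (1 + card S) = coeff (p i) 1 * coeff ?q (card S)"
  proof -
    have "coeff (p i * ?q) (1 + card S) =
        (\<Sum>k\<in>{..1 + card S}. coeff (p i) k * coeff ?q (1 + card S - k))"
      by (rule coeff_mult)
    \<comment> \<open>Only \<open>k = 1\<close> survives: \<open>k = 0\<close> asks for a
      coefficient of \<open>?q\<close> above its degree, and \<open>k > 1\<close> for one of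
      \<open>p i\<close>.\<close>
    also have "\<dots> = (\<Sum>k\<in>{1}. coeff (p i) k * coeff ?q (1 + card S - k))"
    proof (rule sum.mono_neutral_right)
      show "\<forall>k\<in>{..1 + card S} - {1}. coeff (p i) k * coeff ?q (1 + card S - k) = 0"
      proof
        fix k assume "k \<in> {..1 + card S} - {1}"
        then consider "k = 0" | "k > 1" by fastforce
        then show "coeff (p i) k * coeff ?q (1 + card S - k) = 0"
          using p q(1) by cases (simp_all add: coeff_eq_0)
      qed
    qed auto
    finally show ?thesis by simp
  qed
  ultimately show ?case
    using insert.hyps q(2) by simp
qed simp

lemma poly_det: "poly (det P) x = det (\<chi> i j. poly (P $ i $ j) x)"
  for P :: "'b::comm_ring_1 poly ^ 'n::finite ^ 'n"
  by (simp add: det_def poly_sum poly_prod)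

lemma degree_det_le:
  fixes P :: "'b::comm_ring_1 poly ^ 'n::finite ^ 'n"
  assumes "\<And>i j. degree (P $ i $ j) \<le> 1"
  shows "degree (det P) \<le> CARD('n)"
proof -
  have *: "degree (of_int (sign \<sigma>) * (\<Prod>i\<in>UNIV. P $ i $ \<sigma> i)) \<le> CARD('n)" for \<sigma>
  proof -
    have "degree (\<Prod>i\<in>UNIV. P $ i $ \<sigma> i) \<le> CARD('n)"
      using coeff_prod_degree_le_1[of UNIV "\<lambda>i. P $ i $ \<sigma> i"] assms by simp
    then show ?thesis
      by (cases "sign \<sigma> = 1") (auto simp: sign_def)
  qed
  show ?thesis
    unfolding det_def by (rule degree_sum_le) (simp_all add: * finite_permutations)
qed

text \<open>Each Leibniz summand takes one factor per row, so its top coefficient is the product of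
  the linear coefficients. For a matrix \<open>M - x\<close> these form the negated identity, which
  yields the leading coefficient of the characteristic polynomial.\<close>

lemma coeff_det:
  fixes P :: "'b::comm_ring_1 poly ^ 'n::finite ^ 'n"
  assumes "\<And>i j. degree (P $ i $ j) \<le> 1"
  shows "coeff (det P) CARD('n) = det (\<chi> i j. coeff (P $ i $ j) 1)"
proof -
  have "coeff (of_int (sign \<sigma>) * (\<Prod>i\<in>UNIV. P $ i $ \<sigma> i)) CARD('n) =
      of_int (sign \<sigma>) * (\<Prod>i\<in>UNIV. coeff (P $ i $ \<sigma> i) 1)" for \<sigma>
    using coeff_prod_degree_le_1[of UNIV "\<lambda>i. P $ i $ \<sigma> i"] assms
    by (cases "sign \<sigma> = 1") (auto simp: sign_def)
  then show ?thesis
    by (simp add: det_def coeff_sum)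
qed

section \<open>Matrix spectra and eigenvalues of small modulus\<close>

lemma mem_matrix_spectrum_iff: "\<mu> \<in> matrix_spectrum M \<longleftrightarrow> det (M - mat \<mu>) = 0"
  by (simp add: matrix_spectrum_def invertible_det_nz)

lemma zero_mem_matrix_spectrum_iff: "0 \<in> matrix_spectrum M \<longleftrightarrow> det M = 0"
proof -
  have "mat 0 = (0 :: complex ^ 'n ^ 'n)"
    by (simp add: mat_def vec_eq_iff)
  then show ?thesis
    by (simp add: mem_matrix_spectrum_iff)
qed

lemma small_eigenvalue:
  fixes M :: "complex ^ 'n::finite ^ 'n"
  assumes "cmod (det M) < \<epsilon> ^ CARD('n)" and "\<epsilon> > 0"
  obtains \<mu> where "\<mu> \<in> matrix_spectrum M" and "cmod \<mu> < \<epsilon>"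
proof -
  \<comment> \<open>The matrix \<open>M - x\<close> with polynomial entries, so that
    \<open>det P\<close> is the characteristic polynomial and its roots are the spectrum.\<close>
  define P :: "complex poly ^ 'n ^ 'n"
    where "P = (\<chi> i j. [: M $ i $ j, if i = j then - 1 else 0 :])"
  define p where "p = det P"
  have deg: "degree (P $ i $ j) \<le> 1" for i j
    by (simp add: P_def)
  have poly_p: "poly p \<mu> = det (M - mat \<mu>)" for \<mu>
    unfolding p_def poly_det
    by (rule arg_cong[where f = det]) (simp add: P_def mat_def vec_eq_iff)
  have "coeff p CARD('n) = det (\<chi> (i::'n) (j::'n). if i = j then - (1 :: complex) else 0)"
    unfolding p_def coeff_det[OF deg]
    by (rule arg_cong[where f = det]) (simp add: P_def vec_eq_iff)
  also have "\<dots> = (\<Prod>i\<in>(UNIV::'n set). - 1)"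
    by (subst det_diagonal) simp_all
  finally have lead: "coeff p CARD('n) = (- 1) ^ CARD('n)"
    by simp
  \<comment> \<open>The exact degree matters: the number of roots must agree with the exponent of
    \<open>\<epsilon>\<close> in the hypothesis.\<close>
  have degp: "degree p = CARD('n)"
    using degree_det_le[OF deg] le_degree[of p "CARD('n)"] lead
    by (simp add: p_def)
  define A where "A = proots p"
  have A: "size A = degree p" "p = smult (lead_coeff p) (\<Prod>x\<in>#A. [:- x, 1:])"
    by (simp_all only: A_def size_proots_complex complex_poly_decompose_multiset)
  have root: "x \<in> matrix_spectrum M" if "x \<in># A" for x
  proof -
    have "poly (\<Prod>x\<in>#A. [:- x, 1:]) x = 0"
      using that by (force simp: poly_prod_mset image_iff)
    then have "poly p x = 0"
      by (subst A(2)) simp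
    then show ?thesis
      by (simp add: poly_p mem_matrix_spectrum_iff)
  qed
  \<comment> \<open>Evaluating the factorization at \<open>0\<close> turns \<open>p\<close> into
    \<open>det M\<close>; the leading coefficient has modulus \<open>1\<close> and drops
    out.\<close>
  have "cmod (poly p 0) = cmod (\<Prod>x\<in>#A. - x)"
    by (subst A(2)) (simp add: degp lead poly_prod_mset norm_mult norm_power)
  also have "\<dots> = (\<Prod>x\<in>#A. cmod x)"
    by (induction A) (simp_all add: norm_mult)
  finally have prod: "cmod (det M) = (\<Prod>x\<in>#A. cmod x)"
    using poly_p[of 0] by (simp add: mat_def zero_vec_def[symmetric])
  have "\<exists>x\<in>#A. cmod x < \<epsilon>"
  proof (rule ccontr)
    assume "\<not> ?thesis"
    then have "\<epsilon> ^ size A \<le> (\<Prod>x\<in>#A. cmod x)"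
      using \<open>\<epsilon> > 0\<close> by (induction A) (auto intro!: mult_mono)
    then show False
      using prod assms(1) A(1) degp by simp
  qed
  then show thesis
    using root that by blast
qed

section \<open>Inner product and norm\<close>

lemma cinner_diff_left: "cinner (x - y) z = cinner x z - cinner y z"
  using cinner_add_left[of "x - y" y z] by simp

lemma cinner_zero_left: "cinner 0 z = 0"
  using cinner_diff_left[of 0 0 z] by simp

lemma norm_power2_eq_cinner: "(complex_of_real (norm x))\<^sup>2 = cinner x x"
proof -
  have "Im (cinner x x) = 0"
    using arg_cong[OF cinner_commute[of x x], of Im] by simp
  moreover have "(norm x)\<^sup>2 = Re (cinner x x)"
  proof -
    \<comment> \<open>The real \<open>sqrt\<close> is negative on negative arguments, so this
      inequality already forces \<open>Re (cinner x x)\<close> to be nonnegative.\<close>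
    have "0 \<le> sqrt (Re (cinner x x))"
      unfolding norm_eq_sqrt_cinner[symmetric] by simp
    then show ?thesis
      by (simp add: norm_eq_sqrt_cinner)
  qed
  ultimately show ?thesis
    by (simp add: complex_eq_iff flip: of_real_power)
qed

text \<open>The norm axioms give homogeneity for real scalars only; for complex scalars it comes
  from the inner product, by comparing squares.\<close>

lemma norm_scaleC: "norm (a *\<^sub>C x) = cmod a * norm x" for x :: "'a::complex_hilbert_space"
proof -
  have "cinner (a *\<^sub>C x) (a *\<^sub>C x) = a * cnj a * cinner x x"
    by (metis cinner_scaleC_left cinner_commute complex_cnj_mult mult.assoc)
  also have "\<dots> = (complex_of_real (cmod a * norm x))\<^sup>2"
    by (simp add: norm_power2_eq_cinner[symmetric] complex_norm_square[symmetric] power_mult_distrib)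
  finally have "(complex_of_real (norm (a *\<^sub>C x)))\<^sup>2 = (complex_of_real (cmod a * norm x))\<^sup>2"
    by (simp add: norm_power2_eq_cinner)
  then have "(norm (a *\<^sub>C x))\<^sup>2 = (cmod a * norm x)\<^sup>2"
    unfolding of_real_power[symmetric] of_real_eq_iff .
  then show ?thesis
    by simp
qed

section \<open>Operator norms on subspaces and diagonal operators\<close>

lemma subspace_direct_sum:
  assumes "\<And>i. complex_vector.subspace (H i)"
  shows "complex_vector.subspace (direct_sum H)"
  using assms
  by (auto simp: complex_vector.subspace_def direct_sum_def scaleC_vec_def)

lemma onorm_on_le:
  assumes "complex_vector.subspace V" and "\<And>x. x \<in> V \<Longrightarrow> norm (T x) \<le> K * norm x" and "0 \<le> K"
  shows "onorm_on V T \<le> K"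
  unfolding onorm_on_def
proof (rule cSUP_least)
  show "V \<noteq> {}"
    using complex_vector.subspace_0[OF assms(1)] by blast
  \<comment> \<open>At \<open>x = 0\<close> the quotient is \<open>0\<close>, and this is where
    \<open>0 \<le> K\<close> enters.\<close>
  show "norm (T x) / norm x \<le> K" if "x \<in> V" for x
    using assms(2)[OF that] assms(3) by (cases "x = 0") (simp_all add: divide_le_eq)
qed

lemma norm_le_onorm_on:
  assumes "T \<in> bounded_ops V" and "x \<in> V"
  shows "norm (T x) \<le> onorm_on V T * norm x"
proof -
  obtain K where K: "\<And>x. x \<in> V \<Longrightarrow> norm (T x) \<le> K * norm x"
    using assms(1) by (auto simp: bounded_ops_def)
  \<comment> \<open>The constant \<open>K\<close> may be negative when \<open>V\<close> is the zero
    space, while the quotient at \<open>0\<close> equals \<open>0\<close>.\<close>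
  have "norm (T x) / norm x \<le> max K 0" if "x \<in> V" for x
    using K[OF that] by (cases "x = 0") (simp_all add: divide_le_eq le_max_iff_disj)
  then have "bdd_above ((\<lambda>x. norm (T x) / norm x) ` V)"
    by (auto intro!: bdd_aboveI)
  then have "norm (T x) / norm x \<le> onorm_on V T"
    unfolding onorm_on_def using assms(2) by (rule cSUP_upper2[OF _ _ order_refl])
  \<comment> \<open>At \<open>x = 0\<close> the quotient carries no information; there the bound
    with \<open>K\<close> gives \<open>T 0 = 0\<close>.\<close>
  then show ?thesis
    using K[OF assms(2)] by (cases "x = 0") (simp_all add: divide_le_eq)
qed

lemma onorm_on_nonneg:
  assumes "T \<in> bounded_ops V" and "complex_vector.subspace V"
  shows "0 \<le> onorm_on V T"
proof (cases "\<exists>x\<in>V. x \<noteq> 0")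
  case True
  then obtain x where "x \<in> V" "x \<noteq> 0" by blast
  then have "0 \<le> onorm_on V T * norm x"
    using norm_le_onorm_on[OF assms(1)] norm_ge_zero order_trans by blast
  then show ?thesis
    using \<open>x \<noteq> 0\<close> by (simp add: zero_le_mult_iff)
next
  case False
  \<comment> \<open>On the zero space the supremum runs over the single value
    \<open>0\<close>.\<close>
  then have "V = {0}"
    using complex_vector.subspace_0[OF assms(2)] by blast
  then show ?thesis
    by (simp add: onorm_on_def)
qed

lemma scaleC_mem_bounded_ops:
  assumes "complex_vector.subspace V"
  shows "(\<lambda>x. a *\<^sub>C x) \<in> bounded_ops V"
proof -
  have "norm (a *\<^sub>C x) \<le> cmod a * norm x" for x :: 'a
    by (simp add: norm_scaleC)
  then show ?thesis
    unfolding bounded_ops_def linear_on_def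
    using complex_vector.subspace_scale[OF assms]
    by (fastforce simp: scaleC_add_right scaleC_scaleC mult.commute)
qed

lemma onorm_on_scaleC_le:
  assumes "complex_vector.subspace V"
  shows "onorm_on V (\<lambda>x. a *\<^sub>C x) \<le> cmod a"
  by (rule onorm_on_le[OF assms]) (simp_all add: norm_scaleC)

text \<open>The norm of the direct sum is the \<open>L2_set\<close> norm of the component norms,
  which is monotone and lets the common constant factor out.\<close>

lemma norm_diag_op_le:
  assumes "f \<in> direct_sum H" and "0 \<le> K"
    and "\<And>i x. x \<in> H i \<Longrightarrow> norm (B i x) \<le> K * norm x"
  shows "norm (diag_op B f) \<le> K * norm f"
proof -
  have "norm (diag_op B f) \<le> L2_set (\<lambda>i. K * norm (f $ i)) UNIV"
    unfolding norm_vec_def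
    by (rule L2_set_mono) (use assms in \<open>auto simp: diag_op_def direct_sum_def\<close>)
  also have "\<dots> = K * norm f"
    unfolding norm_vec_def using assms(2) by (simp add: L2_set_right_distrib)
  finally show ?thesis .
qed

lemma diag_op_mem_bounded_ops:
  assumes "\<And>i. complex_vector.subspace (H i)" and "\<And>i. B i \<in> bounded_ops (H i)"
    and "\<And>i. onorm_on (H i) (B i) < \<epsilon>"
  shows "diag_op B \<in> bounded_ops (direct_sum H)" and "onorm_on (direct_sum H) (diag_op B) < \<epsilon>"
proof -
  \<comment> \<open>A maximum over the finite index type stays strictly below
    \<open>\<epsilon>\<close>; using \<open>\<epsilon>\<close> itself as the bound would lose
    strictness.\<close>
  define K where "K = (MAX i. onorm_on (H i) (B i))"
  have le_K: "onorm_on (H i) (B i) \<le> K" for i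
    by (simp add: K_def)
  have "K < \<epsilon>"
    using assms(3) by (simp add: K_def)
  have "0 \<le> K"
    using onorm_on_nonneg[OF assms(2,1)] le_K by (rule order_trans)
  have "norm (B i x) \<le> K * norm x" if "x \<in> H i" for i x
    using norm_le_onorm_on[OF assms(2) that] le_K[of i]
    by (meson mult_right_mono norm_ge_zero order_trans)
  then have bound: "norm (diag_op B f) \<le> K * norm f" if "f \<in> direct_sum H" for f
    using norm_diag_op_le[OF that \<open>0 \<le> K\<close>] by blast
  have "diag_op B \<in> direct_sum H \<rightarrow> direct_sum H" "linear_on (direct_sum H) (diag_op B)"
    using assms(2)
    by (auto simp: bounded_ops_def direct_sum_def diag_op_def linear_on_def scaleC_vec_def
        vec_eq_iff Pi_iff)
  with bound show "diag_op B \<in> bounded_ops (direct_sum H)"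
    by (auto simp: bounded_ops_def)
  show "onorm_on (direct_sum H) (diag_op B) < \<epsilon>"
    using onorm_on_le[OF subspace_direct_sum[OF assms(1)] bound \<open>0 \<le> K\<close>] \<open>K < \<epsilon>\<close>
    by (rule le_less_trans)
qed

section \<open>Compressions of perturbed operator matrices\<close>

lemma matrix_dom_perturb: "matrix_dom (perturb A B) = matrix_dom A"
  by (simp add: matrix_dom_def perturb_def)

lemma compression_perturb_diag_scaleC:
  assumes "f \<in> unit_product H"
  shows "compression (perturb A (diag_op (\<lambda>i x. (- \<mu>) *\<^sub>C x))) f = compression A f - mat \<mu>"
proof -
  have "cinner (f $ i) (f $ i) = 1" for i
    using assms norm_power2_eq_cinner[of "f $ i"] by (simp add: unit_product_def)
  \<comment> \<open>For \<open>i \<noteq> j\<close> component \<open>i\<close> of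
    \<open>axis j x\<close> is \<open>0\<close>, so only diagonal entries of the compression
    change.\<close>
  then show ?thesis
    by (auto simp: vec_eq_iff compression_def perturb_def diag_op_def axis_def mat_def
        cinner_add_left cinner_diff_left cinner_zero_left cinner_scaleC_left)
qed

section \<open>The four inclusions\<close>

lemma bnr_family_subset_pseudo_bnr1: "bnr_family H \<Omega> L \<subseteq> pseudo_bnr1 H \<Omega> L"
proof
  fix z assume "z \<in> bnr_family H \<Omega> L"
  then obtain f where "z \<in> \<Omega>" "f \<in> matrix_dom (L z) \<inter> unit_product H"
    "det (compression (L z) f) = 0"
    unfolding bnr_family_def zero_mem_matrix_spectrum_iff by blast
  moreover from this have "cmod (det (compression (L z) f)) < \<epsilon>" if "\<epsilon> > 0" for \<epsilon>
    using that by simp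
  ultimately show "z \<in> pseudo_bnr1 H \<Omega> L"
    unfolding pseudo_bnr1_def bnr_eps1_def by blast
qed

lemma pseudo_bnr1_subset_pseudo_bnr0:
  fixes H :: "'n::finite \<Rightarrow> 'a::complex_hilbert_space set"
  shows "pseudo_bnr1 H \<Omega> L \<subseteq> pseudo_bnr0 H \<Omega> L"
proof
  fix z assume z: "z \<in> pseudo_bnr1 H \<Omega> L"
  \<comment> \<open>The parameter is rescaled to the power that \<open>small_eigenvalue\<close> asks
    for.\<close>
  have *: "z \<in> bnr_eps1 H \<Omega> L (\<epsilon> ^ CARD('n))" if "\<epsilon> > 0" for \<epsilon>
    using z that by (simp add: pseudo_bnr1_def)
  have "\<exists>\<mu>\<in>bnr H (L z). dist \<mu> 0 < \<epsilon>" if \<epsilon>: "\<epsilon> > 0" for \<epsilon>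
  proof -
    obtain f where "f \<in> matrix_dom (L z) \<inter> unit_product H"
      "cmod (det (compression (L z) f)) < \<epsilon> ^ CARD('n)"
      using *[OF \<epsilon>] by (auto simp: bnr_eps1_def)
    then show ?thesis
      using small_eigenvalue[OF _ \<epsilon>, of "compression (L z) f"] by (force simp: bnr_def)
  qed
  moreover have "z \<in> \<Omega>"
    using *[of 1] by (simp add: bnr_eps1_def)
  ultimately show "z \<in> pseudo_bnr0 H \<Omega> L"
    by (simp add: pseudo_bnr0_def closure_approachable)
qed

lemma pseudo_bnr0_subset_pseudo_bnr2:
  assumes "\<And>i. complex_vector.subspace (H i)"
  shows "pseudo_bnr0 H \<Omega> L \<subseteq> pseudo_bnr2 H \<Omega> L"
proof
  fix z assume z: "z \<in> pseudo_bnr0 H \<Omega> L"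
  have "z \<in> bnr_eps2 H \<Omega> L \<epsilon>" if \<epsilon>: "\<epsilon> > 0" for \<epsilon>
  proof -
    obtain \<mu> where "\<mu> \<in> bnr H (L z)" and \<mu>: "cmod \<mu> < \<epsilon>"
      using z \<epsilon> unfolding pseudo_bnr0_def closure_approachable by auto
    then obtain f where f: "f \<in> matrix_dom (L z)" "f \<in> unit_product H"
      and sp: "\<mu> \<in> matrix_spectrum (compression (L z) f)"
      by (auto simp: bnr_def)
    \<comment> \<open>The shift \<open>\<mu>\<close> was found at this \<open>z\<close>, yet
      \<open>B\<close> perturbs the whole family; only membership of this one \<open>z\<close> has
      to be checked.\<close>
    define B :: "'a \<Rightarrow> 'b \<Rightarrow> 'b" where "B = (\<lambda>i x. (- \<mu>) *\<^sub>C x)"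
    have "det (compression (perturb (L z) (diag_op B)) f) = 0"
      using sp unfolding B_def compression_perturb_diag_scaleC[OF f(2)]
      by (simp add: mem_matrix_spectrum_iff)
    then have "z \<in> bnr_family H \<Omega> (\<lambda>z. perturb (L z) (diag_op B))"
      using z f
      by (auto simp: bnr_family_def matrix_dom_perturb zero_mem_matrix_spectrum_iff pseudo_bnr0_def)
    moreover have "B i \<in> bounded_ops (H i)" for i
      unfolding B_def by (rule scaleC_mem_bounded_ops[OF assms])
    moreover have "onorm_on (H i) (B i) < \<epsilon>" for i
      using le_less_trans[OF onorm_on_scaleC_le[OF assms, where a = "- \<mu>"]] \<mu>
      unfolding B_def by (metis norm_minus_cancel)
    ultimately show ?thesis
      unfolding bnr_eps2_def by blast
  qed
  then show "z \<in> pseudo_bnr2 H \<Omega> L"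
    by (simp add: pseudo_bnr2_def)
qed

text \<open>The inclusion already holds for each fixed \<open>\<epsilon>\<close>, since
  \<open>diag_op B\<close> is itself an admissible perturbation of the direct sum.\<close>

lemma pseudo_bnr2_subset_pseudo_bnr:
  assumes "\<And>i. complex_vector.subspace (H i)"
  shows "pseudo_bnr2 H \<Omega> L \<subseteq> pseudo_bnr H \<Omega> L"
proof -
  have "bnr_eps2 H \<Omega> L \<epsilon> \<subseteq> bnr_eps H \<Omega> L \<epsilon>" for \<epsilon>
  proof
    fix z assume "z \<in> bnr_eps2 H \<Omega> L \<epsilon>"
    then obtain B where B: "\<And>i. B i \<in> bounded_ops (H i)" "\<And>i. onorm_on (H i) (B i) < \<epsilon>"
      and z: "z \<in> bnr_family H \<Omega> (\<lambda>z. perturb (L z) (diag_op B))"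
      by (auto simp: bnr_eps2_def)
    have "diag_op B \<in> {B \<in> bounded_ops (direct_sum H). onorm_on (direct_sum H) B < \<epsilon>}"
      using diag_op_mem_bounded_ops[where H = H and B = B, OF assms B] by simp
    then show "z \<in> bnr_eps H \<Omega> L \<epsilon>"
      unfolding bnr_eps_def UN_iff using z by - (rule bexI[where x = "diag_op B"])
  qed
  then show ?thesis
    unfolding pseudo_bnr2_def pseudo_bnr_def by (rule INT_anti_mono[OF order_refl])
qed

theorem proposition4p4:
  fixes H :: "'n::finite \<Rightarrow> 'a::complex_hilbert_space set"
    and \<Omega> :: "complex set"
    and L :: "complex \<Rightarrow> ('a, 'n) operator_matrix"
  assumes "open \<Omega>" and "connected \<Omega>" and "\<Omega> \<noteq> {}"
    and "\<And>i. hilbert_subspace (H i)"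
    and "\<And>z. z \<in> \<Omega> \<Longrightarrow> is_operator_matrix H (L z)"
  shows "bnr_family H \<Omega> L \<subseteq> pseudo_bnr1 H \<Omega> L \<and>
    pseudo_bnr1 H \<Omega> L \<subseteq> pseudo_bnr0 H \<Omega> L \<and>
    pseudo_bnr0 H \<Omega> L \<subseteq> pseudo_bnr2 H \<Omega> L \<and>
    pseudo_bnr2 H \<Omega> L \<subseteq> pseudo_bnr H \<Omega> L"
proof -
  have "complex_vector.subspace (H i)" for i
    using assms(4) by (simp add: hilbert_subspace_def)
  then show ?thesis
    by (intro conjI bnr_family_subset_pseudo_bnr1 pseudo_bnr1_subset_pseudo_bnr0
        pseudo_bnr0_subset_pseudo_bnr2 pseudo_bnr2_subset_pseudo_bnr)
qed

end
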